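(* $$\delta^+_\chi(C'_5,2)=\delta^+_\chi(C''_5,2)=\delta^+_\chi(C'''_5,2)=\frac13 ,$$ where $C_5'$, $C_5''$, $C_5'''$ are the three orientations of the 5-cycle that are not directed cycles.
   Context: All digraphs are finite, may contain anti-parallel arcs (both $(u,v)$ and $(v,u)$), and have no loops or parallel arcs. $|D|$ is the number of vertices of $D$ and $\delta^+(D)$ its minimum out-degree. The underlying graph $G(D)$ is the simple graph on $V(D)$ in which $\{u,v\}$ is an edge iff $(u,v)$ or $(v,u)$ is an arc of $D$; $\chi(D)$ is the chromatic number of $G(D)$. $H\subseteq D$ means that $D$ contains a (not necessarily induced) subdigraph isomorphic to $H$. The chromatic profile of a digraph $H$ is $$\delta^+_\chi(H,k):=\inf\{d:\ \delta^+(D)\ge d|D| \text{ and } H\not\subseteq D \Rightarrow \chi(D)\le k\},$$ where the implication is over digraphs $D$. On vertices $a,b,c,d,e$, the three orientations of the 5-cycle are: - $C_5'$ with arcs $a\to b,\ b\to c,\ c\to d,\ d\to e,\ a\to e$; - $C_5''$ with arcs $a\to b,\ b\to c,\ c\to d,\ a\to e,\ e\to d$; - $C_5'''$ with arcs $a\to b,\ b\to c,\ d\to c,\ d\to e,\ a\to e$.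
   Formalization: In the chromatic profile, the implication is required only for all sufficiently large digraphs D (size bound depending on d); over all digraphs the claim fails, since the complete digraph on 4 vertices forces each value to be at least 3/4. *)

theory Defs
  imports
    Complex_Main
    "Graph_Theory.Digraph_Component"
    "Graph_Theory.Digraph_Isomorphism"
    "Graph_Theory.Pair_Digraph"
begin

text \<open>
  A finite digraph without loops and parallel arcs (anti-parallel arcs allowed) is a
  \<^typ>\<open>'a pair_pre_digraph\<close> satisfying \<^const>\<open>pair_digraph\<close>.
\<close>

definition min_out_degree :: "'a pair_pre_digraph \<Rightarrow> nat" where
  "min_out_degree D = Min (out_degree (with_proj D) ` pverts D)"

definition underlying_edges :: "'a pair_pre_digraph \<Rightarrow> 'a set set" where
  "underlying_edges D =
     {{u, v} | u v. u \<in> pverts D \<and> v \<in> pverts D \<and> ((u, v) \<in> parcs D \<or> (v, u) \<in> parcs D)}"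

definition proper_colouring :: "'a set \<Rightarrow> 'a set set \<Rightarrow> nat \<Rightarrow> ('a \<Rightarrow> nat) \<Rightarrow> bool" where
  "proper_colouring V E k f \<longleftrightarrow>
     (\<forall>v\<in>V. f v < k) \<and> (\<forall>u\<in>V. \<forall>v\<in>V. {u, v} \<in> E \<longrightarrow> f u \<noteq> f v)"

definition chromatic_number :: "'a set \<Rightarrow> 'a set set \<Rightarrow> nat" where
  "chromatic_number V E = (LEAST k. \<exists>f. proper_colouring V E k f)"

definition digraph_chi :: "'a pair_pre_digraph \<Rightarrow> nat" where
  "digraph_chi D = chromatic_number (pverts D) (underlying_edges D)"

definition contains_digraph :: "'a pair_pre_digraph \<Rightarrow> 'h pair_pre_digraph \<Rightarrow> bool" where
  "contains_digraph D H \<longleftrightarrow>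
     (\<exists>H'. subgraph H' (with_proj D) \<and> digraph_iso (with_proj H) H')"

text \<open>
  The chromatic profile. As usual for extremal thresholds, the implication is required for all
  sufficiently large digraphs \<open>D\<close>, where the bound on \<open>|D|\<close> may depend on \<open>d\<close>. Requiring it for
  every digraph would let digraphs with fewer vertices than \<open>H\<close> decide the value: the complete
  digraph on four vertices contains no orientation of the 5-cycle, has minimum out-degree 3 and
  chromatic number 4, so that every profile of such an orientation with \<open>k = 2\<close> would be at
  least 3/4.

  Every finite digraph is isomorphic to one whose vertices are natural numbers, so nothing is lost
  by letting \<open>D\<close> range over these. The infimum is the one of the reals, meaningful when the set
  is nonempty and bounded below.
\<close>

definition chromatic_profile :: "'h pair_pre_digraph \<Rightarrow> nat \<Rightarrow> real" where
  "chromatic_profile H k =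
     Inf {d :: real. \<exists>n\<^sub>0 :: nat. \<forall>D :: nat pair_pre_digraph.
            pair_digraph D \<and> n\<^sub>0 \<le> card (pverts D) \<longrightarrow>
            real (min_out_degree D) \<ge> d * real (card (pverts D)) \<and> \<not> contains_digraph D H \<longrightarrow>
            digraph_chi D \<le> k}"

text \<open>The vertices \<open>a, b, c, d, e\<close> are \<open>0, 1, 2, 3, 4\<close>.\<close>

definition C5_1 :: "nat pair_pre_digraph" where
  "C5_1 = \<lparr>pverts = {0, 1, 2, 3, 4}, parcs = {(0, 1), (1, 2), (2, 3), (3, 4), (0, 4)}\<rparr>"

definition C5_2 :: "nat pair_pre_digraph" where
  "C5_2 = \<lparr>pverts = {0, 1, 2, 3, 4}, parcs = {(0, 1), (1, 2), (2, 3), (0, 4), (4, 3)}\<rparr>"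

definition C5_3 :: "nat pair_pre_digraph" where
  "C5_3 = \<lparr>pverts = {0, 1, 2, 3, 4}, parcs = {(0, 1), (1, 2), (3, 2), (3, 4), (0, 4)}\<rparr>"

end

theory Submission
  imports Defs
begin

text \<open>
  Call two vertices similar if they have at least 12 common out-neighbours. If the minimum
  out-degree is at least $(1/3 + \varepsilon) n$ with $n$ large, then among any three vertices two
  are similar. When an orientation of the 5-cycle is excluded, embedding short walks shows that
  adjacent vertices are never similar and have no common similar vertex. Hence, for any fixed vertex
  $x$, both the set of vertices that are similar or equal to $x$ and its complement are
  independent. For the lower bounds, \<open>C5_2\<close> and \<open>C5_3\<close> admit no
  homomorphism to a directed triangle, whose balanced blow-up has minimum out-degree $n/3$. For
  \<open>C5_1\<close>, three classes $A_1 \leftrightarrow B_1 \leftarrow A_2$ of size $m$ and two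
  further vertices $v$, $b$ with $v \to A_2$ and $v \to b \to A_1$ form a blow-up of an orientation
  of the 5-cycle that allows no walk of length four between the ends of an arc.
\<close>

section \<open>Subdigraphs and two-colourings\<close>

text \<open>Compatibility with \<open>with_proj D\<close> forces the tail and head maps of the
  isomorphic copy to be \<open>fst\<close> and \<open>snd\<close>, so the vertex map determines the
  arc map. This reduces containment to injective homomorphisms.\<close>

lemma contains_digraph_iff:
  assumes D: "pair_wf_digraph D" and H: "pair_wf_digraph H"
  shows "contains_digraph D H \<longleftrightarrow>
    (\<exists>f. inj_on f (pverts H) \<and> f ` pverts H \<subseteq> pverts D \<and>
       (\<forall>u v. (u, v) \<in> parcs H \<longrightarrow> (f u, f v) \<in> parcs D))"
proof
  assume "contains_digraph D H"
  then obtain h where sub: "subgraph (app_iso h (with_proj H)) (with_proj D)"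
    and iso: "pre_digraph.digraph_isomorphism (with_proj H) h"
    unfolding contains_digraph_def digraph_iso_def by blast
  have tails: "iso_tail h = fst" "iso_head h = snd"
    using sub by (auto simp: subgraph_def compatible_def)
  have "(iso_verts h u, iso_verts h v) \<in> parcs D" if "(u, v) \<in> parcs H" for u v
  proof -
    have "iso_verts h u = fst (iso_arcs h (u, v))" "iso_verts h v = snd (iso_arcs h (u, v))"
      using iso that tails unfolding pre_digraph.digraph_isomorphism_def by force+
    moreover have "iso_arcs h (u, v) \<in> parcs D"
      using sub that by (auto simp: subgraph_def)
    ultimately show ?thesis by simp
  qed
  moreover have "inj_on (iso_verts h) (pverts H)"
    using iso by (simp add: pre_digraph.digraph_isomorphism_def)
  moreover have "iso_verts h ` pverts H \<subseteq> pverts D"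
    using sub by (simp add: subgraph_def)
  ultimately show "\<exists>f. inj_on f (pverts H) \<and> f ` pverts H \<subseteq> pverts D \<and>
      (\<forall>u v. (u, v) \<in> parcs H \<longrightarrow> (f u, f v) \<in> parcs D)"
    by blast
next
  assume "\<exists>f. inj_on f (pverts H) \<and> f ` pverts H \<subseteq> pverts D \<and>
      (\<forall>u v. (u, v) \<in> parcs H \<longrightarrow> (f u, f v) \<in> parcs D)"
  then obtain f where f: "inj_on f (pverts H)" "f ` pverts H \<subseteq> pverts D"
    "\<And>u v. (u, v) \<in> parcs H \<Longrightarrow> (f u, f v) \<in> parcs D"
    by blast
  define h where "h = \<lparr>iso_verts = f, iso_arcs = map_prod f f, iso_head = snd, iso_tail = fst\<rparr>"
  have ends: "u \<in> pverts H" "v \<in> pverts H" if "(u, v) \<in> parcs H" for u v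
    using pair_wf_digraph.in_arcsD1[OF H that] pair_wf_digraph.in_arcsD2[OF H that] by auto
  have "inj_on (map_prod f f) (parcs H)"
    using f(1) ends by (auto simp: inj_on_def)
  then have iso: "pre_digraph.digraph_isomorphism (with_proj H) h"
    using f(1) H by (auto simp: pre_digraph.digraph_isomorphism_def h_def wf_digraph_wp_iff)
  have "wf_digraph (app_iso h (with_proj H))"
    using ends by unfold_locales (auto simp: h_def)
  then have "subgraph (app_iso h (with_proj H)) (with_proj D)"
    using f D by (auto simp: subgraph_def compatible_def h_def wf_digraph_wp_iff)
  with iso show "contains_digraph D H"
    unfolding contains_digraph_def digraph_iso_def by blast
qed

lemma pair_wf_digraph_C5: "pair_wf_digraph C5_1" "pair_wf_digraph C5_2" "pair_wf_digraph C5_3"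
  by (unfold_locales; auto simp: C5_1_def C5_2_def C5_3_def)+

lemma contains_C5I:
  assumes D: "pair_wf_digraph D" and dist: "distinct [a, b, c, d, e]"
  shows "{(a, b), (b, c), (c, d), (d, e), (a, e)} \<subseteq> parcs D \<Longrightarrow> contains_digraph D C5_1"
    and "{(a, b), (b, c), (c, d), (a, e), (e, d)} \<subseteq> parcs D \<Longrightarrow> contains_digraph D C5_2"
    and "{(a, b), (b, c), (d, c), (d, e), (a, e)} \<subseteq> parcs D \<Longrightarrow> contains_digraph D C5_3"
proof -
  define f where "f = (\<lambda>i::nat. [a, b, c, d, e] ! i)"
  have f: "f 0 = a" "f (Suc 0) = b" "f 2 = c" "f 3 = d" "f 4 = e"
    by (simp_all add: f_def)
  note wf = pair_wf_digraph.in_arcsD1[OF D] pair_wf_digraph.in_arcsD2[OF D]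
  show "contains_digraph D C5_1" if "{(a, b), (b, c), (c, d), (d, e), (a, e)} \<subseteq> parcs D"
    unfolding contains_digraph_iff[OF D pair_wf_digraph_C5(1)]
    using that dist by (intro exI[of _ f]) (auto simp: C5_1_def inj_on_def f dest: wf)
  show "contains_digraph D C5_2" if "{(a, b), (b, c), (c, d), (a, e), (e, d)} \<subseteq> parcs D"
    unfolding contains_digraph_iff[OF D pair_wf_digraph_C5(2)]
    using that dist by (intro exI[of _ f]) (auto simp: C5_2_def inj_on_def f dest: wf)
  show "contains_digraph D C5_3" if "{(a, b), (b, c), (d, c), (d, e), (a, e)} \<subseteq> parcs D"
    unfolding contains_digraph_iff[OF D pair_wf_digraph_C5(3)]
    using that dist by (intro exI[of _ f]) (auto simp: C5_3_def inj_on_def f dest: wf)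
qed

text \<open>Only a homomorphism is extracted: the blow-ups that give the lower bounds do not even
  receive a homomorphism from the cycle in question.\<close>

lemma contains_C5D:
  assumes D: "pair_wf_digraph D"
  shows "contains_digraph D C5_1 \<Longrightarrow>
      \<exists>a b c d e. {(a, b), (b, c), (c, d), (d, e), (a, e)} \<subseteq> parcs D"
    and "contains_digraph D C5_2 \<Longrightarrow>
      \<exists>a b c d e. {(a, b), (b, c), (c, d), (a, e), (e, d)} \<subseteq> parcs D"
    and "contains_digraph D C5_3 \<Longrightarrow>
      \<exists>a b c d e. {(a, b), (b, c), (d, c), (d, e), (a, e)} \<subseteq> parcs D"
proof -
  assume "contains_digraph D C5_1"
  then obtain f where "(u, v) \<in> parcs C5_1 \<Longrightarrow> (f u, f v) \<in> parcs D" for u v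
    unfolding contains_digraph_iff[OF D pair_wf_digraph_C5(1)] by blast
  then show "\<exists>a b c d e. {(a, b), (b, c), (c, d), (d, e), (a, e)} \<subseteq> parcs D"
    by (intro exI[of _ "f 0"] exI[of _ "f 1"] exI[of _ "f 2"] exI[of _ "f 3"] exI[of _ "f 4"])
      (simp add: C5_1_def)
next
  assume "contains_digraph D C5_2"
  then obtain f where "(u, v) \<in> parcs C5_2 \<Longrightarrow> (f u, f v) \<in> parcs D" for u v
    unfolding contains_digraph_iff[OF D pair_wf_digraph_C5(2)] by blast
  then show "\<exists>a b c d e. {(a, b), (b, c), (c, d), (a, e), (e, d)} \<subseteq> parcs D"
    by (intro exI[of _ "f 0"] exI[of _ "f 1"] exI[of _ "f 2"] exI[of _ "f 3"] exI[of _ "f 4"])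
      (simp add: C5_2_def)
next
  assume "contains_digraph D C5_3"
  then obtain f where "(u, v) \<in> parcs C5_3 \<Longrightarrow> (f u, f v) \<in> parcs D" for u v
    unfolding contains_digraph_iff[OF D pair_wf_digraph_C5(3)] by blast
  then show "\<exists>a b c d e. {(a, b), (b, c), (d, c), (d, e), (a, e)} \<subseteq> parcs D"
    by (intro exI[of _ "f 0"] exI[of _ "f 1"] exI[of _ "f 2"] exI[of _ "f 3"] exI[of _ "f 4"])
      (simp add: C5_3_def)
qed

lemma digraph_chi_leI:
  assumes "\<And>v. v \<in> pverts D \<Longrightarrow> f v < k" and "\<And>u v. (u, v) \<in> parcs D \<Longrightarrow> f u \<noteq> f v"
  shows "digraph_chi D \<le> k"
  unfolding digraph_chi_def chromatic_number_def
proof (rule Least_le, rule exI)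
  show "proper_colouring (pverts D) (underlying_edges D) k f"
    using assms unfolding proper_colouring_def underlying_edges_def
    by (auto simp: doubleton_eq_iff) metis+
qed

lemma digraph_chi_leD:
  fixes D :: "nat pair_pre_digraph"
  assumes D: "pair_digraph D" and "digraph_chi D \<le> k"
  obtains f :: "nat \<Rightarrow> nat" where "\<And>v. v \<in> pverts D \<Longrightarrow> f v < k"
    and "\<And>u v. (u, v) \<in> parcs D \<Longrightarrow> f u \<noteq> f v"
proof -
  interpret pair_digraph D by (rule D)
  \<comment> \<open>The \<open>LEAST\<close> is attained only if some proper colouring exists.
    Vertices are natural numbers and there are no loops, so the identity is one, with
    \<open>N\<close> colours.\<close>
  obtain N where "pverts D \<subseteq> {..<N}"
    using finite_nat_bounded pair_finite_verts by blast
  then have "proper_colouring (pverts D) (underlying_edges D) N (\<lambda>v. v)"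
    using no_loops' unfolding proper_colouring_def underlying_edges_def
    by (auto simp: doubleton_eq_iff)
  then have "\<exists>f. proper_colouring (pverts D) (underlying_edges D) (digraph_chi D) f"
    unfolding digraph_chi_def chromatic_number_def
    by (intro LeastI_ex[of "\<lambda>k. \<exists>f. proper_colouring (pverts D) (underlying_edges D) k f"]) blast
  then obtain f where f: "proper_colouring (pverts D) (underlying_edges D) (digraph_chi D) f"
    by blast
  have "f v < k" if "v \<in> pverts D" for v
    using f that assms(2) unfolding proper_colouring_def by (meson order_less_le_trans)
  moreover have "f u \<noteq> f v" if "(u, v) \<in> parcs D" for u v
    using f that in_arcsD1[OF that] in_arcsD2[OF that]
    unfolding proper_colouring_def underlying_edges_def by blast
  ultimately show thesis by (rule that)
qed

section \<open>Digraphs of large minimum out-degree\<close>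

text \<open>Isolates what a large minimum out-degree provides. The threshold 12 exceeds the number
  of vertices that a fresh vertex must avoid in any argument below; the longest such list has nine
  entries.\<close>

locale dense_digraph =
  fixes V :: "'a set" and E :: "'a rel"
  assumes wf: "E \<subseteq> V \<times> V"
    and irrefl: "(x, x) \<notin> E"
    and out_degree: "x \<in> V \<Longrightarrow> 12 \<le> card (E `` {x})"
    and three: "\<lbrakk>x \<in> V; y \<in> V; z \<in> V; distinct [x, y, z]\<rbrakk> \<Longrightarrow>
      12 \<le> card (E `` {x} \<inter> E `` {y}) \<or> 12 \<le> card (E `` {x} \<inter> E `` {z}) \<or>
      12 \<le> card (E `` {y} \<inter> E `` {z})"
begin

definition sim :: "'a \<Rightarrow> 'a \<Rightarrow> bool" (infix \<open>\<approx>\<close> 50) where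
  "x \<approx> y \<longleftrightarrow> 12 \<le> card (E `` {x} \<inter> E `` {y})"

lemma sim_sym: "x \<approx> y \<longleftrightarrow> y \<approx> x"
  by (simp add: sim_def Int_commute)

lemma in_V: "(x, y) \<in> E \<Longrightarrow> x \<in> V" "(x, y) \<in> E \<Longrightarrow> y \<in> V"
  using wf by auto

lemma not_eq: "(x, y) \<in> E \<Longrightarrow> x \<noteq> y"
  using irrefl by auto

text \<open>The working form of \<open>three\<close>: the arguments below produce two vertices not
  similar to a common \<open>z\<close> and conclude that these two are similar.\<close>

lemma sim_three: "\<lbrakk>x \<in> V; y \<in> V; z \<in> V; x \<noteq> y; y \<noteq> z; \<not> z \<approx> x; \<not> z \<approx> y; x \<noteq> z\<rbrakk> \<Longrightarrow> x \<approx> y"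
  using three[of z x y] by (simp add: sim_def Int_commute)

lemma fresh:
  assumes "12 \<le> card A" "length xs < 12"
  shows "\<exists>y \<in> A. y \<notin> set xs"
proof (rule ccontr)
  assume "\<not> ?thesis"
  then have "card A \<le> card (set xs)" by (intro card_mono) auto
  with assms card_length[of xs] show False by linarith
qed

lemma fresh_out:
  assumes "x \<in> V" "length xs < 12"
  obtains y where "(x, y) \<in> E" "y \<notin> set xs" "x \<noteq> y" "y \<in> V"
  using fresh[OF out_degree] assms in_V not_eq by (metis Image_singleton_iff)

text \<open>This is how similarity is exploited: the common out-neighbour can be chosen off all
  earlier vertices, which keeps the embedded cycle injective.\<close>

lemma fresh_common:
  assumes "x \<approx> y" "length xs < 12"
  obtains z where "(x, z) \<in> E" "(y, z) \<in> E" "z \<notin> set xs" "x \<noteq> z" "y \<noteq> z" "z \<in> V"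
proof -
  obtain z where "z \<in> E `` {x} \<inter> E `` {y}" "z \<notin> set xs"
    using fresh assms unfolding sim_def by blast
  then show thesis using that[of z] in_V not_eq by blast
qed

text \<open>An arc between two vertices of colour 0 contradicts \<open>arc\<close> if one end is
  \<open>x\<close>, and \<open>third\<close> with \<open>z = x\<close> otherwise. Two distinct
  vertices of colour 1 are not similar to \<open>x\<close>, hence similar to each other, and
  \<open>arc\<close> applies.\<close>

lemma two_colouring:
  assumes arc: "\<And>x y. (x, y) \<in> E \<Longrightarrow> \<not> x \<approx> y"
    and third: "\<And>x y z. \<lbrakk>(x, y) \<in> E; z \<noteq> x; z \<noteq> y; z \<approx> x; z \<approx> y\<rbrakk> \<Longrightarrow> False"
  shows "\<exists>f :: 'a \<Rightarrow> nat. \<forall>u v. f v < 2 \<and> ((u, v) \<in> E \<longrightarrow> f u \<noteq> f v)"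
proof (cases "E = {}")
  case True
  then show ?thesis by (intro exI[of _ "\<lambda>_. 0"]) simp
next
  case False
  then obtain x where x: "x \<in> V" using in_V by auto
  define f :: "'a \<Rightarrow> nat" where "f v = (if v = x \<or> x \<approx> v then 0 else 1)" for v
  have "f u \<noteq> f v" if uv: "(u, v) \<in> E" for u v
  proof
    assume "f u = f v"
    then consider "u = x \<or> x \<approx> u" "v = x \<or> x \<approx> v"
      | "u \<noteq> x" "\<not> x \<approx> u" "v \<noteq> x" "\<not> x \<approx> v"
      unfolding f_def by (auto split: if_splits)
    then show False
    proof cases
      case 1
      then show ?thesis using arc[OF uv] third[OF uv, of x] not_eq[OF uv] sim_sym by blast
    next
      case 2
      then have "u \<approx> v" using sim_three[of u v x] x in_V[OF uv] not_eq[OF uv] by blast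
      with arc[OF uv] show ?thesis by blast
    qed
  qed
  moreover have "f v < 2" for v by (simp add: f_def)
  ultimately show ?thesis by blast
qed

section \<open>Two-colourability when one orientation of the 5-cycle is excluded\<close>

lemma two_colouring_no_C5_1:
  assumes no: "\<And>a b c d e. \<lbrakk>distinct [a, b, c, d, e];
    {(a, b), (b, c), (c, d), (d, e), (a, e)} \<subseteq> E\<rbrakk> \<Longrightarrow> False"
  shows "\<exists>f :: 'a \<Rightarrow> nat. \<forall>u v. f v < 2 \<and> ((u, v) \<in> E \<longrightarrow> f u \<noteq> f v)"
proof -
  \<comment> \<open>A common out-neighbour of the ends of a path with three arcs closes a
    \<open>C5_1\<close>.\<close>
  have walk: "\<not> a \<approx> d" if "(a, b) \<in> E" "(b, c) \<in> E" "(c, d) \<in> E" "distinct [a, b, c, d]" for a b c d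
  proof
    assume "a \<approx> d"
    then obtain e where "(a, e) \<in> E" "(d, e) \<in> E" "e \<notin> set [a, b, c, d]"
      by (rule fresh_common[of a d "[a, b, c, d]"]) simp_all
    then show False using no[of a b c d e] that by auto
  qed
  \<comment> \<open>An arc with similar ends lies in a transitive triangle, whose last vertex is
    reached from the first in one and in two steps. Prolonging both routes makes \<open>walk\<close>
    apply to the two ends of a further arc, which are therefore similar again.\<close>
  have arc: "\<not> x \<approx> y" if xy: "(x, y) \<in> E" for x y
  proof
    assume sim: "x \<approx> y"
    have x: "x \<in> V" "x \<noteq> y" using xy in_V not_eq by auto
    obtain w where w: "(x, w) \<in> E" "(y, w) \<in> E" "w \<notin> set [x, y]" "w \<in> V"
      using sim by (rule fresh_common[of x y "[x, y]"]) simp_all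
    obtain t where t: "(w, t) \<in> E" "t \<notin> set [x, y, w]" "t \<in> V"
      using w(4) by (rule fresh_out[of w "[x, y, w]"]) simp_all
    obtain s where s: "(t, s) \<in> E" "s \<notin> set [x, y, w, t]" "s \<in> V"
      using t(3) by (rule fresh_out[of t "[x, y, w, t]"]) simp_all
    have "\<not> x \<approx> t" "\<not> x \<approx> s"
      using walk[of x y w t] walk[of x w t s] xy x w t s by auto
    then have "t \<approx> s" using sim_three[of t s x] x t s by auto
    then obtain r where r: "(t, r) \<in> E" "(s, r) \<in> E" "r \<notin> set [x, y, w, t, s]" "r \<in> V"
      by (rule fresh_common[of t s "[x, y, w, t, s]"]) simp_all
    obtain q where q: "(r, q) \<in> E" "q \<notin> set [x, y, w, t, s, r]" "q \<in> V"
      using r(4) by (rule fresh_out[of r "[x, y, w, t, s, r]"]) simp_all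
    \<comment> \<open>The triangle \<open>t\<close>, \<open>s\<close>, \<open>r\<close> gives paths
      with three arcs from \<open>w\<close> to \<open>r\<close> and, through \<open>r\<close>, to
      any fresh out-neighbour of \<open>r\<close>. So \<open>r\<close> is similar to all of these,
      in particular to \<open>q\<close> and \<open>p\<close>.\<close>
    have wr: "\<not> w \<approx> r" "\<not> w \<approx> q"
      using walk[of w t s r] walk[of w t r q] w t s r q by auto
    then have "r \<approx> q" using sim_three[of r q w] w r q by auto
    then obtain p where p: "(r, p) \<in> E" "(q, p) \<in> E" "p \<notin> set [x, y, w, t, s, r, q]" "p \<in> V"
      by (rule fresh_common[of r q "[x, y, w, t, s, r, q]"]) simp_all
    have "\<not> w \<approx> p" using walk[of w t r p] w t r p by auto
    then have "r \<approx> p" using sim_three[of r p w] wr w r p by auto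
    then obtain o' where o: "(r, o') \<in> E" "(p, o') \<in> E" "o' \<notin> set [x, y, w, t, s, r, q, p]" "o' \<in> V"
      by (rule fresh_common[of r p "[x, y, w, t, s, r, q, p]"]) simp_all
    obtain u where u: "(o', u) \<in> E" "u \<notin> set [x, y, w, t, s, r, q, p, o']" "u \<in> V"
      using o(4) by (rule fresh_out[of o' "[x, y, w, t, s, r, q, p, o']"]) simp_all
    \<comment> \<open>The contradiction: \<open>q\<close> and \<open>u\<close> both end paths with
      three arcs from \<open>t\<close>, so they are similar, yet \<open>q\<close>, \<open>p\<close>,
      \<open>o'\<close>, \<open>u\<close> is itself such a path.\<close>
    have "\<not> t \<approx> q" "\<not> t \<approx> u"
      using walk[of t s r q] walk[of t r o' u] t s r q o u by auto
    then have "q \<approx> u" using sim_three[of q u t] t q u by auto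
    moreover have "\<not> q \<approx> u" using walk[of q p o' u] q p o u by auto
    ultimately show False by blast
  qed
  have third: False if xy: "(x, y) \<in> E" and z: "z \<noteq> x" "z \<noteq> y" "z \<approx> x" "z \<approx> y" for x y z
  proof -
    have x: "x \<in> V" "x \<noteq> y" using xy in_V not_eq by auto
    obtain c where c: "(z, c) \<in> E" "(y, c) \<in> E" "c \<notin> set [x, y, z]" "c \<in> V"
      using z(4) by (rule fresh_common[of z y "[x, y, z]"]) simp_all
    obtain d where d: "(z, d) \<in> E" "(x, d) \<in> E" "d \<notin> set [x, y, z, c]" "d \<in> V"
      using z(3) by (rule fresh_common[of z x "[x, y, z, c]"]) simp_all
    \<comment> \<open>Both are out-neighbours of \<open>z\<close>, so by \<open>arc\<close> neither
      is similar to \<open>z\<close>. Their common out-neighbour \<open>f\<close> is then reached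
      from \<open>x\<close> by three arcs through \<open>c\<close> and by two through
      \<open>d\<close>, which makes the arc from \<open>f\<close> to \<open>g\<close> have similar
      ends.\<close>
    have "c \<approx> d" using sim_three[of c d z] arc[OF c(1)] arc[OF d(1)] c d in_V[OF c(1)] by auto
    then obtain f where f: "(c, f) \<in> E" "(d, f) \<in> E" "f \<notin> set [x, y, z, c, d]" "f \<in> V"
      by (rule fresh_common[of c d "[x, y, z, c, d]"]) simp_all
    obtain g where g: "(f, g) \<in> E" "g \<notin> set [x, y, z, c, d, f]" "g \<in> V"
      using f(4) by (rule fresh_out[of f "[x, y, z, c, d, f]"]) simp_all
    have "\<not> x \<approx> f" "\<not> x \<approx> g"
      using walk[of x y c f] walk[of x d f g] xy x c d f g by auto
    then have "f \<approx> g" using sim_three[of f g x] x f g by auto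
    with arc[OF g(1)] show False by blast
  qed
  show ?thesis by (rule two_colouring) (erule arc, erule (4) third)
qed

lemma two_colouring_no_C5_2:
  assumes no: "\<And>a b c d e. \<lbrakk>distinct [a, b, c, d, e];
    {(a, b), (b, c), (c, d), (a, e), (e, d)} \<subseteq> E\<rbrakk> \<Longrightarrow> False"
  shows "\<exists>f :: 'a \<Rightarrow> nat. \<forall>u v. f v < 2 \<and> ((u, v) \<in> E \<longrightarrow> f u \<noteq> f v)"
proof -
  \<comment> \<open>A common out-neighbour of \<open>e\<close> and \<open>c\<close> is the sink
    \<open>d\<close> of a \<open>C5_2\<close>.\<close>
  have walk: "\<not> e \<approx> c" if "(a, b) \<in> E" "(b, c) \<in> E" "(a, e) \<in> E" "distinct [a, b, c, e]" for a b c e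
  proof
    assume "e \<approx> c"
    then obtain d where "(e, d) \<in> E" "(c, d) \<in> E" "d \<notin> set [a, b, c, e]"
      by (rule fresh_common[of e c "[a, b, c, e]"]) simp_all
    then show False using no[of a b c d e] that by auto
  qed
  \<comment> \<open>Both \<open>e\<close> and \<open>e'\<close> are compared with the end
    \<open>c\<close> of one path \<open>x\<close>, \<open>b\<close>, \<open>c\<close>;
    \<open>walk\<close> makes \<open>c\<close> similar to neither.\<close>
  have clique: "e \<approx> e'" if e: "(x, e) \<in> E" "(x, e') \<in> E" "e \<noteq> e'" for x e e'
  proof -
    have x: "x \<in> V" "x \<noteq> e" "x \<noteq> e'" "e \<in> V" "e' \<in> V" using e in_V not_eq by auto
    obtain b where b: "(x, b) \<in> E" "b \<notin> set [x, e, e']" "b \<in> V"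
      using x(1) by (rule fresh_out[of x "[x, e, e']"]) simp_all
    obtain c where c: "(b, c) \<in> E" "c \<notin> set [x, e, e', b]" "c \<in> V"
      using b(3) by (rule fresh_out[of b "[x, e, e', b]"]) simp_all
    have "\<not> e \<approx> c" "\<not> e' \<approx> c"
      using walk[of x b c e] walk[of x b c e'] x e b c by auto
    then show ?thesis using sim_three[of e e' c] x e c sim_sym by auto
  qed
  have arc: "\<not> x \<approx> y" if xy: "(x, y) \<in> E" for x y
  proof
    assume "x \<approx> y"
    then obtain c where c: "(x, c) \<in> E" "(y, c) \<in> E" "c \<notin> set [x, y]"
      by (rule fresh_common[of x y "[x, y]"]) simp_all
    have x: "x \<in> V" "x \<noteq> y" using xy in_V not_eq by auto
    obtain e where e: "(x, e) \<in> E" "e \<notin> set [x, y, c]"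
      using x(1) by (rule fresh_out[of x "[x, y, c]"]) simp_all
    have "\<not> e \<approx> c" using walk[of x y c e] xy x c e by auto
    moreover have "e \<approx> c" using clique[of x e c] c e by auto
    ultimately show False by blast
  qed
  have third: False if xy: "(x, y) \<in> E" and z: "z \<noteq> x" "z \<noteq> y" "z \<approx> x" "z \<approx> y" for x y z
  proof -
    have x: "x \<noteq> y" using xy not_eq by auto
    obtain c where c: "(z, c) \<in> E" "(y, c) \<in> E" "c \<notin> set [x, y, z]"
      using z(4) by (rule fresh_common[of z y "[x, y, z]"]) simp_all
    obtain d where d: "(z, d) \<in> E" "(x, d) \<in> E" "d \<notin> set [x, y, z, c]"
      using z(3) by (rule fresh_common[of z x "[x, y, z, c]"]) simp_all
    have "d \<approx> c" using clique[of z d c] c d by auto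
    moreover have "\<not> d \<approx> c" using walk[of x y c d] xy x c d by auto
    ultimately show False by blast
  qed
  show ?thesis by (rule two_colouring) (erule arc, erule (4) third)
qed

lemma two_colouring_no_C5_3:
  assumes no: "\<And>a b c d e. \<lbrakk>distinct [a, b, c, d, e];
    {(a, b), (b, c), (d, c), (d, e), (a, e)} \<subseteq> E\<rbrakk> \<Longrightarrow> False"
  shows "\<exists>f :: 'a \<Rightarrow> nat. \<forall>u v. f v < 2 \<and> ((u, v) \<in> E \<longrightarrow> f u \<noteq> f v)"
proof -
  \<comment> \<open>Here the order is reversed: \<open>third\<close> is immediate, as
    \<open>z\<close> plays the vertex \<open>d\<close> of \<open>C5_3\<close>, and
    \<open>arc\<close> is derived from it.\<close>
  have third: False if xy: "(x, y) \<in> E" and z: "z \<noteq> x" "z \<noteq> y" "z \<approx> x" "z \<approx> y" for x y z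
  proof -
    have x: "x \<noteq> y" using xy not_eq by auto
    obtain c where c: "(z, c) \<in> E" "(y, c) \<in> E" "c \<notin> set [x, y, z]"
      using z(4) by (rule fresh_common[of z y "[x, y, z]"]) simp_all
    obtain e where e: "(z, e) \<in> E" "(x, e) \<in> E" "e \<notin> set [x, y, z, c]"
      using z(3) by (rule fresh_common[of z x "[x, y, z, c]"]) simp_all
    show False using no[of x y c z e] xy x z c e by auto
  qed
  have arc: "\<not> x \<approx> y" if xy: "(x, y) \<in> E" for x y
  proof
    assume sim: "x \<approx> y"
    have x: "x \<in> V" "y \<in> V" "x \<noteq> y" using xy in_V not_eq by auto
    obtain w where w: "(x, w) \<in> E" "(y, w) \<in> E" "w \<notin> set [x, y]" "w \<in> V"
      using sim by (rule fresh_common[of x y "[x, y]"]) simp_all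
    have xw: "\<not> x \<approx> w" "\<not> y \<approx> w"
      using third[OF w(2), of x] third[OF w(1), of y] sim sim_sym x w by auto
    \<comment> \<open>By \<open>third\<close> on the arc from \<open>x\<close> to \<open>y\<close>,
      at least one of \<open>x\<close>, \<open>y\<close> is not similar to \<open>t\<close>. Neither
      is similar to \<open>w\<close>, so that one serves as the common non-similar vertex.\<close>
    have out: "w \<approx> t" if t: "(w, t) \<in> E" "t \<notin> set [x, y]" for t
    proof -
      have t': "t \<in> V" "w \<noteq> t" using in_V(2)[OF t(1)] not_eq[OF t(1)] .
      have "\<not> x \<approx> t \<or> \<not> y \<approx> t" using third[OF xy, of t] t sim_sym by auto
      then show ?thesis
        using sim_three[of w t x] sim_three[of w t y] xw x w t t' by auto
    qed
    obtain t where t: "(w, t) \<in> E" "t \<notin> set [x, y, w]" "t \<in> V"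
      using w(4) by (rule fresh_out[of w "[x, y, w]"]) simp_all
    have wt: "w \<approx> t" using out t by auto
    then obtain s where s: "(w, s) \<in> E" "(t, s) \<in> E" "s \<notin> set [x, y, w, t]"
      by (rule fresh_common[of w t "[x, y, w, t]"]) simp_all
    \<comment> \<open>Now \<open>w\<close> is similar to both ends of the arc from \<open>t\<close>
      to \<open>s\<close>, which \<open>third\<close> forbids.\<close>
    have "w \<approx> s" using out s by auto
    then show False using third[OF s(2), of w] wt t s by auto
  qed
  show ?thesis by (rule two_colouring) (erule arc, erule (4) third)
qed

end

section \<open>From minimum out-degree to the value of the profile\<close>

lemma card_out_arcs: "out_degree (with_proj D) x = card (parcs D `` {x})"
proof -
  have "out_arcs (with_proj D) x = Pair x ` (parcs D `` {x})"
    by (auto simp: out_arcs_def)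
  then show ?thesis by (simp add: out_degree_def card_image inj_on_def)
qed

text \<open>Three out-neighbourhoods of total size at least $3dn$ lie in a set of size $n$, so their
  pairwise intersections have total size at least $(3d-1)n$. As this is at least 36, one of the
  three has at least 12 elements.\<close>

lemma dense_digraphI:
  assumes D: "pair_digraph D"
    and deg: "d * real (card (pverts D)) \<le> real (min_out_degree D)"
    and large: "36 \<le> (3 * d - 1) * real (card (pverts D))"
  shows "dense_digraph (pverts D) (parcs D)"
proof -
  interpret pair_digraph D by (rule D)
  let ?N = "\<lambda>x. parcs D `` {x}"
  let ?n = "card (pverts D)"
  have sub: "?N x \<subseteq> pverts D" for x
    using in_arcsD2 by auto
  then have fin: "finite (?N x)" for x
    using pair_finite_verts finite_subset by blast
  have degree: "d * real ?n \<le> real (card (?N x))" if "x \<in> pverts D" for x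
  proof -
    have "min_out_degree D \<le> card (?N x)"
      unfolding min_out_degree_def card_out_arcs using that pair_finite_verts by (intro Min_le) auto
    with deg show ?thesis by linarith
  qed
  show ?thesis
  proof
    show "parcs D \<subseteq> pverts D \<times> pverts D" using in_arcsD1 in_arcsD2 by auto
    show "(x, x) \<notin> parcs D" for x using no_loops' by blast
    show "12 \<le> card (?N x)" if "x \<in> pverts D" for x
      using degree[OF that] large by (simp add: algebra_simps)
  next
    fix x y z assume xyz: "x \<in> pverts D" "y \<in> pverts D" "z \<in> pverts D" "distinct [x, y, z]"
    have "card (?N x) + card (?N y) + card (?N z) \<le>
        card (?N x \<union> ?N y \<union> ?N z) + card (?N x \<inter> ?N y) + card ((?N x \<union> ?N y) \<inter> ?N z)"
      using card_Un_Int[OF fin fin, of x y] card_Un_Int[of "?N x \<union> ?N y" "?N z"] fin by simp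
    moreover have "card ((?N x \<union> ?N y) \<inter> ?N z) \<le> card (?N x \<inter> ?N z) + card (?N y \<inter> ?N z)"
      by (metis Int_Un_distrib2 card_Un_le)
    moreover have "card (?N x \<union> ?N y \<union> ?N z) \<le> ?n"
      using sub pair_finite_verts by (intro card_mono) auto
    ultimately have "card (?N x) + card (?N y) + card (?N z) \<le>
        ?n + card (?N x \<inter> ?N y) + card (?N x \<inter> ?N z) + card (?N y \<inter> ?N z)"
      by linarith
    then have "36 \<le> card (?N x \<inter> ?N y) + card (?N x \<inter> ?N z) + card (?N y \<inter> ?N z)"
      using degree xyz(1-3)[THEN degree] large by (simp add: algebra_simps)
    then show "12 \<le> card (?N x \<inter> ?N y) \<or> 12 \<le> card (?N x \<inter> ?N z) \<or> 12 \<le> card (?N y \<inter> ?N z)"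
      by linarith
  qed
qed

text \<open>Reduces each profile to a colouring statement above 1/3 and a family of examples below
  it. The constant \<open>l\<close> allows a bounded number of extra vertices, which do not affect
  the limiting ratio 1/3.\<close>

lemma chromatic_profile_eq_third:
  assumes upper: "\<And>D :: nat pair_pre_digraph. \<lbrakk>pair_digraph D; dense_digraph (pverts D) (parcs D);
      \<not> contains_digraph D H\<rbrakk> \<Longrightarrow> digraph_chi D \<le> k"
    and lower: "\<And>m. 0 < m \<Longrightarrow> \<exists>D :: nat pair_pre_digraph. pair_digraph D \<and>
      card (pverts D) = 3 * m + l \<and> m \<le> min_out_degree D \<and> \<not> contains_digraph D H \<and>
      \<not> digraph_chi D \<le> k"
  shows "chromatic_profile H k = 1 / 3"
proof -
  define S where "S = {d :: real. \<exists>n\<^sub>0 :: nat. \<forall>D :: nat pair_pre_digraph.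
            pair_digraph D \<and> n\<^sub>0 \<le> card (pverts D) \<longrightarrow>
            real (min_out_degree D) \<ge> d * real (card (pverts D)) \<and> \<not> contains_digraph D H \<longrightarrow>
            digraph_chi D \<le> k}"
  have above: "d \<in> S" if "1 / 3 < d" for d
  proof -
    obtain n\<^sub>0 :: nat where n0: "36 / (3 * d - 1) \<le> real n\<^sub>0"
      using real_arch_simple by blast
    have "digraph_chi D \<le> k" if D: "pair_digraph D" "n\<^sub>0 \<le> card (pverts D)"
      "real (min_out_degree D) \<ge> d * real (card (pverts D))" "\<not> contains_digraph D H"
      for D :: "nat pair_pre_digraph"
    proof -
      have "36 / (3 * d - 1) \<le> real (card (pverts D))" using n0 D(2) by linarith
      then have "36 \<le> (3 * d - 1) * real (card (pverts D))"
        using \<open>1 / 3 < d\<close> by (simp add: field_simps)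
      then show ?thesis using upper dense_digraphI D by blast
    qed
    then show ?thesis unfolding S_def by blast
  qed
  have below: "1 / 3 \<le> d" if S: "d \<in> S" for d
  proof (rule ccontr)
    assume d: "\<not> 1 / 3 \<le> d"
    obtain n\<^sub>0 where n0: "\<forall>D :: nat pair_pre_digraph. pair_digraph D \<and> n\<^sub>0 \<le> card (pverts D) \<longrightarrow>
        real (min_out_degree D) \<ge> d * real (card (pverts D)) \<and> \<not> contains_digraph D H \<longrightarrow>
        digraph_chi D \<le> k"
      using S unfolding S_def by blast
    obtain m\<^sub>0 :: nat where m0: "real l / (1 - 3 * d) \<le> real m\<^sub>0"
      using real_arch_simple by blast
    \<comment> \<open>The summand \<open>n\<^sub>0\<close> makes the example large enough,
      \<open>m\<^sub>0\<close> absorbs the \<open>l\<close> extra vertices into the gap between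
      \<open>d\<close> and 1/3, and 1 keeps \<open>m\<close> positive.\<close>
    define m where "m = n\<^sub>0 + m\<^sub>0 + 1"
    obtain D :: "nat pair_pre_digraph" where D: "pair_digraph D" "card (pverts D) = 3 * m + l"
      "m \<le> min_out_degree D" "\<not> contains_digraph D H" "\<not> digraph_chi D \<le> k"
      using lower[of m] by (auto simp: m_def)
    have "real l / (1 - 3 * d) \<le> real m" using m0 by (simp add: m_def)
    then have "real l \<le> (1 - 3 * d) * real m" using d by (simp add: field_simps)
    moreover have "d * real l \<le> real l" using d mult_right_mono[of d 1 "real l"] by simp
    ultimately have "d * real (3 * m + l) \<le> real m" by (simp add: algebra_simps)
    then have "d * real (card (pverts D)) \<le> real (min_out_degree D)" using D(2,3) by simp
    moreover have "n\<^sub>0 \<le> card (pverts D)" using D(2) by (simp add: m_def)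
    ultimately show False using n0 D by blast
  qed
  have "Inf S = 1 / 3"
  proof (rule antisym)
    show "1 / 3 \<le> Inf S"
      \<comment> \<open>The instance \<open>d = 1\<close> shows that the set is nonempty.\<close>
      using above[of 1] below by (intro cInf_greatest) auto
    have "bdd_below S" using below by (rule bdd_belowI)
    show "Inf S \<le> 1 / 3"
    proof (rule field_le_epsilon)
      fix e :: real assume "0 < e"
      then show "Inf S \<le> 1 / 3 + e"
        using above \<open>bdd_below S\<close> by (intro cInf_lower) auto
    qed
  qed
  then show ?thesis by (simp add: chromatic_profile_def S_def)
qed

section \<open>Blow-ups\<close>

definition class_of :: "nat \<Rightarrow> nat \<Rightarrow> nat" where
  "class_of m i = (if i < 3 * m then i mod 3 else 3 + (i - 3 * m))"

text \<open>The classes 0, 1, 2 have size \<open>m\<close>, and the classes \<open>3, \<dots>, l + 2\<close> are singletons.\<close>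

definition blowup :: "nat \<Rightarrow> nat \<Rightarrow> nat rel \<Rightarrow> nat pair_pre_digraph" where
  "blowup m l R = \<lparr>pverts = {..<3 * m + l},
     parcs = {(i, j). i < 3 * m + l \<and> j < 3 * m + l \<and> (class_of m i, class_of m j) \<in> R}\<rparr>"

lemma pair_digraph_blowup:
  assumes "irrefl R"
  shows "pair_digraph (blowup m l R)"
proof
  show "finite (parcs (blowup m l R))"
    by (rule finite_subset[of _ "{..<3 * m + l} \<times> {..<3 * m + l}"]) (auto simp: blowup_def)
qed (use assms in \<open>auto simp: blowup_def irrefl_def\<close>)

text \<open>It suffices that every class dominates one of the classes of size \<open>m\<close>;
  class \<open>j < 3\<close> consists of the numbers \<open>3 * q + j\<close> with
  \<open>q < m\<close>.\<close>

lemma min_out_degree_blowup: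
  assumes "0 < m" and R: "\<And>i. i < 3 + l \<Longrightarrow> \<exists>j < 3 :: nat. (i, j) \<in> R"
  shows "m \<le> min_out_degree (blowup m l R)"
proof -
  let ?D = "blowup m l R"
  have "m \<le> card (parcs ?D `` {i})" if i: "i < 3 * m + l" for i
  proof -
    have "class_of m i < 3 + l" using i by (auto simp: class_of_def)
    then obtain j where j: "j < 3" "(class_of m i, j) \<in> R" using R by blast
    have "3 * q + j < 3 * m" if "q < m" for q using that j(1) by linarith
    then have "(\<lambda>q. 3 * q + j) ` {..<m} \<subseteq> parcs ?D `` {i}"
      using i j by (fastforce simp: blowup_def class_of_def)
    moreover have "finite (parcs ?D `` {i})"
      by (rule finite_subset[of _ "{..<3 * m + l}"]) (auto simp: blowup_def)
    ultimately have "card ((\<lambda>q. 3 * q + j) ` {..<m}) \<le> card (parcs ?D `` {i})"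
      by (rule card_mono[rotated])
    then show ?thesis by (simp add: card_image inj_on_def)
  qed
  moreover have "pverts ?D = {..<3 * m + l}" "0 \<in> {..<3 * m + l}"
    using assms(1) by (simp_all add: blowup_def)
  ultimately show ?thesis
    unfolding min_out_degree_def card_out_arcs by (intro Min.boundedI) force+
qed

text \<open>A closed walk in the directed triangle has its forward minus backward arcs divisible by
  3. Around \<open>C5_2\<close> and \<open>C5_3\<close> this difference is 1 up to sign; around
  \<open>C5_1\<close> it is 3, so that cycle does map to the triangle and requires another
  construction.\<close>

lemma triangle_blowup:
  assumes "0 < m"
  defines "D \<equiv> blowup m 0 {(0, 1), (1, 2), (2, 0)}"
  shows "pair_digraph D" "card (pverts D) = 3 * m + 0" "m \<le> min_out_degree D"
    "\<not> contains_digraph D C5_2" "\<not> contains_digraph D C5_3" "\<not> digraph_chi D \<le> 2"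
proof -
  show D: "pair_digraph D"
    unfolding D_def by (rule pair_digraph_blowup) (auto simp: irrefl_def)
  show "card (pverts D) = 3 * m + 0" by (simp add: D_def blowup_def)
  show "m \<le> min_out_degree D"
    unfolding D_def
  proof (rule min_out_degree_blowup[OF assms(1)])
    fix i :: nat assume "i < 3 + 0"
    then have "i = 0 \<or> i = 1 \<or> i = 2" by linarith
    then show "\<exists>j < 3 :: nat. (i, j) \<in> {(0, 1), (1, 2), (2, 0)}" by auto
  qed
  have wf: "pair_wf_digraph D" using D by (simp add: pair_digraph.pair_wf_digraph)
  have arcs: "(u, v) \<in> parcs D \<Longrightarrow> (class_of m u, class_of m v) \<in> {(0, 1), (1, 2), (2, 0)}" for u v
    by (simp add: D_def blowup_def)
  show "\<not> contains_digraph D C5_2"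
  proof
    assume "contains_digraph D C5_2"
    then obtain a b c d e where "{(a, b), (b, c), (c, d), (a, e), (e, d)} \<subseteq> parcs D"
      using contains_C5D(2)[OF wf] by iprover
    then show False
      using arcs[of a b] arcs[of b c] arcs[of c d] arcs[of a e] arcs[of e d] by auto
  qed
  show "\<not> contains_digraph D C5_3"
  proof
    assume "contains_digraph D C5_3"
    then obtain a b c d e where "{(a, b), (b, c), (d, c), (d, e), (a, e)} \<subseteq> parcs D"
      using contains_C5D(3)[OF wf] by iprover
    then show False
      using arcs[of a b] arcs[of b c] arcs[of d c] arcs[of d e] arcs[of a e] by auto
  qed
  show "\<not> digraph_chi D \<le> 2"
  proof
    assume "digraph_chi D \<le> 2"
    then obtain f :: "nat \<Rightarrow> nat"
      where f: "\<And>v. v \<in> pverts D \<Longrightarrow> f v < 2" "\<And>u v. (u, v) \<in> parcs D \<Longrightarrow> f u \<noteq> f v"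
      using digraph_chi_leD[OF D] by blast
    have "(0, 1) \<in> parcs D" "(1, 2) \<in> parcs D" "(2, 0) \<in> parcs D" "{0, 1, 2} \<subseteq> pverts D"
      using assms(1) by (auto simp: D_def blowup_def class_of_def)
    then show False using f(1)[of 0] f(1)[of 1] f(1)[of 2] f(2)[of 0 1] f(2)[of 1 2] f(2)[of 2 0]
      by auto
  qed
qed

text \<open>Classes 0, 1, 2 are $A_1$, $B_1$, $A_2$, and the singletons 3 and 4 are $b$ and
  $v$.\<close>

lemma pentagon_blowup:
  assumes "0 < m"
  defines "D \<equiv> blowup m 2 {(0, 1), (1, 0), (2, 1), (4, 2), (4, 3), (3, 0)}"
  shows "pair_digraph D" "card (pverts D) = 3 * m + 2" "m \<le> min_out_degree D"
    "\<not> contains_digraph D C5_1" "\<not> digraph_chi D \<le> 2"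
proof -
  show D: "pair_digraph D"
    unfolding D_def by (rule pair_digraph_blowup) (auto simp: irrefl_def)
  show "card (pverts D) = 3 * m + 2" by (simp add: D_def blowup_def)
  show "m \<le> min_out_degree D"
    unfolding D_def
  proof (rule min_out_degree_blowup[OF assms(1)])
    fix i :: nat assume "i < 3 + 2"
    then consider "i = 0" | "i = 1" | "i = 2" | "i = 3" | "i = 4" by linarith
    then show "\<exists>j < 3 :: nat. (i, j) \<in> {(0, 1), (1, 0), (2, 1), (4, 2), (4, 3), (3, 0)}"
      \<comment> \<open>Entry \<open>i\<close> of the list is a class of size \<open>m\<close>
        dominated by class \<open>i\<close>.\<close>
      by cases (intro exI[of _ "[1, 0, 1, 0, 2] ! i"]; simp)+
  qed
  have wf: "pair_wf_digraph D" using D by (simp add: pair_digraph.pair_wf_digraph)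
  have arcs: "(u, v) \<in> parcs D \<Longrightarrow>
      (class_of m u, class_of m v) \<in> {(0, 1), (1, 0), (2, 1), (4, 2), (4, 3), (3, 0)}" for u v
    by (simp add: D_def blowup_def)
  show "\<not> contains_digraph D C5_1"
  proof
    assume "contains_digraph D C5_1"
    then obtain a b c d e where "{(a, b), (b, c), (c, d), (d, e), (a, e)} \<subseteq> parcs D"
      using contains_C5D(1)[OF wf] by iprover
    then have cycle: "(a, b) \<in> parcs D" "(b, c) \<in> parcs D" "(c, d) \<in> parcs D"
        "(d, e) \<in> parcs D" "(a, e) \<in> parcs D"
      by simp_all
    \<comment> \<open>The listed pairs are the class pairs joined by two steps. Two steps always end
      in class 0 or 1 and fix these classes, so four steps give the same pairs, none of which is an
      arc of the pattern.\<close>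
    have walk: "(class_of m u, class_of m w) \<in> {(0, 0), (1, 1), (2, 0), (3, 1), (4, 0), (4, 1)}"
      if "(u, v) \<in> parcs D" "(v, w) \<in> parcs D" for u v w
      using arcs[OF that(1)] arcs[OF that(2)] by (elim insertE) simp_all
    have "(class_of m a, class_of m e) \<in> {(0, 0), (1, 1), (2, 0), (3, 1), (4, 0), (4, 1)}"
      using walk[OF cycle(1,2)] walk[OF cycle(3,4)] by (elim insertE) simp_all
    then show False
      using arcs[OF cycle(5)] by (elim insertE) simp_all
  qed
  show "\<not> digraph_chi D \<le> 2"
  proof
    assume "digraph_chi D \<le> 2"
    then obtain f :: "nat \<Rightarrow> nat"
      where f: "\<And>v. v \<in> pverts D \<Longrightarrow> f v < 2" "\<And>u v. (u, v) \<in> parcs D \<Longrightarrow> f u \<noteq> f v"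
      using digraph_chi_leD[OF D] by blast
    \<comment> \<open>These are the vertices of the singleton classes; with 0, 1, 2 they form the
      odd cycle 0, 1, 2, \<open>?v\<close>, \<open>?b\<close> in the underlying graph.\<close>
    let ?b = "3 * m" and ?v = "3 * m + 1"
    have arcs: "(0, 1) \<in> parcs D" "(2, 1) \<in> parcs D" "(?v, 2) \<in> parcs D" "(?v, ?b) \<in> parcs D"
        "(?b, 0) \<in> parcs D" and "{0, 1, 2, ?b, ?v} \<subseteq> pverts D"
      using assms(1) by (auto simp: D_def blowup_def class_of_def)
    then have "f 0 < 2" "f 1 < 2" "f 2 < 2" "f ?b < 2" "f ?v < 2"
      using f(1) by blast+
    then show False using arcs[THEN f(2)] by linarith
  qed
qed

theorem theorem1p4:
  shows "chromatic_profile C5_1 2 = 1 / 3 \<and>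
         chromatic_profile C5_2 2 = 1 / 3 \<and>
         chromatic_profile C5_3 2 = 1 / 3"
proof (intro conjI)
  show "chromatic_profile C5_1 2 = 1 / 3"
  proof (rule chromatic_profile_eq_third)
    fix D :: "nat pair_pre_digraph"
    assume D: "pair_digraph D" "dense_digraph (pverts D) (parcs D)" "\<not> contains_digraph D C5_1"
    have "\<exists>f :: nat \<Rightarrow> nat. \<forall>u v. f v < 2 \<and> ((u, v) \<in> parcs D \<longrightarrow> f u \<noteq> f v)"
      using D(3) by (intro dense_digraph.two_colouring_no_C5_1[OF D(2)])
        (erule notE, erule (1) contains_C5I(1)[OF pair_digraph.pair_wf_digraph[OF D(1)]])
    then obtain f :: "nat \<Rightarrow> nat"
      where "\<And>v. f v < 2" "\<And>u v. (u, v) \<in> parcs D \<Longrightarrow> f u \<noteq> f v"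
      by blast
    then show "digraph_chi D \<le> 2" by (rule digraph_chi_leI)
  qed (intro exI conjI; erule pentagon_blowup)
  show "chromatic_profile C5_2 2 = 1 / 3"
  proof (rule chromatic_profile_eq_third)
    fix D :: "nat pair_pre_digraph"
    assume D: "pair_digraph D" "dense_digraph (pverts D) (parcs D)" "\<not> contains_digraph D C5_2"
    have "\<exists>f :: nat \<Rightarrow> nat. \<forall>u v. f v < 2 \<and> ((u, v) \<in> parcs D \<longrightarrow> f u \<noteq> f v)"
      using D(3) by (intro dense_digraph.two_colouring_no_C5_2[OF D(2)])
        (erule notE, erule (1) contains_C5I(2)[OF pair_digraph.pair_wf_digraph[OF D(1)]])
    then obtain f :: "nat \<Rightarrow> nat"
      where "\<And>v. f v < 2" "\<And>u v. (u, v) \<in> parcs D \<Longrightarrow> f u \<noteq> f v"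
      by blast
    then show "digraph_chi D \<le> 2" by (rule digraph_chi_leI)
  qed (intro exI conjI; erule triangle_blowup)
  show "chromatic_profile C5_3 2 = 1 / 3"
  proof (rule chromatic_profile_eq_third)
    fix D :: "nat pair_pre_digraph"
    assume D: "pair_digraph D" "dense_digraph (pverts D) (parcs D)" "\<not> contains_digraph D C5_3"
    have "\<exists>f :: nat \<Rightarrow> nat. \<forall>u v. f v < 2 \<and> ((u, v) \<in> parcs D \<longrightarrow> f u \<noteq> f v)"
      using D(3) by (intro dense_digraph.two_colouring_no_C5_3[OF D(2)])
        (erule notE, erule (1) contains_C5I(3)[OF pair_digraph.pair_wf_digraph[OF D(1)]])
    then obtain f :: "nat \<Rightarrow> nat"
      where "\<And>v. f v < 2" "\<And>u v. (u, v) \<in> parcs D \<Longrightarrow> f u \<noteq> f v"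
      by blast
    then show "digraph_chi D \<le> 2" by (rule digraph_chi_leI)
  qed (intro exI conjI; erule triangle_blowup)
qed

end
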